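(* Let $R$ be a finite rack, and let $G$ be any group whose underlying set is the underlying set of $R$ (no compatibility between the group structure and the rack operations is assumed). Consider the crossed module $(\mathrm{id}\colon G\to G,\mathrm{ad})$, where $G$ acts on itself by conjugation, and define $\psi,\phi\colon G\times G\to G$ by $$\psi(B,A)=B\,A\,B^{-1}(B\triangleright A)^{-1},\qquad \phi(B,A)=A\,B\,(A\triangleleft B)^{-1}B^{-1},$$ where $\triangleright,\triangleleft$ are the rack operations. Then $\Phi=(\psi,\phi)$ is a framed Reidemeister pair for this crossed module. Moreover, if $R$ is a quandle then $\Phi$ is an unframed Reidemeister pair.
   Context: A rack is a set $R$ with operations $(x,y)\mapsto x\triangleright y$ and $(x,y)\mapsto x\triangleleft y$ such that for all $x,y,z$: $x\triangleright(y\triangleleft x)=y$; $(x\triangleright y)\triangleleft x=y$; $x\triangleright(y\triangleright z)=(x\triangleright y)\triangleright(x\triangleright z)$; $(x\triangleleft y)\triangleleft z=(x\triangleleft z)\triangleleft(y\triangleleft z)$. A quandle is a rack with $x\triangleleft x=x=x\triangleright x$ for all $x$. A crossed module $(\mu\colon P\to H,\cdot)$ is a group morphism $\mu$ with a left action of $H$ on $P$ by automorphisms such that $\mu(g\cdot e)=g\mu(e)g^{-1}$ and $\mu(e)\cdot f=efe^{-1}$. For such a crossed module, functions $\psi,\phi\colon H\times H\to P$ form an unframed Reidemeister pair if for all $X,Y,T\in H$: (R1) $\psi(X,X)=1$; (R2) $\phi(X,Y)\,\psi(X,Z)=1$, where $Z=X^{-1}\mu(\phi(X,Y))^{-1}YX$;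 (R3) $\phi(Y,X)\,(Y\cdot\phi(T,Z))\,\phi(T,Y)=(X\cdot\phi(T,Y))\,\phi(T,X)\,(T\cdot\phi(V,W))$, where $Z=Y^{-1}\mu(\phi(Y,X))^{-1}XY$, $V=T^{-1}\mu(\phi(T,Y))^{-1}YT$, $W=T^{-1}\mu(\phi(T,X))^{-1}XT$. They form a framed Reidemeister pair if (R2) and (R3) hold and moreover (i) for each $Z\in H$ the equation $\mu(\phi(A,Z))A=Z$ has a unique solution $A=f(Z)\in H$; (ii) with $g(A)=\mu(\psi(A,A))^{-1}A$ one has $f\circ g=g\circ f=\mathrm{id}_H$. *)

theory Defs
  imports "HOL-Algebra.Bij"
begin

locale rack =
  fixes R :: "'a set"
    and rt :: "'a \<Rightarrow> 'a \<Rightarrow> 'a"  (infixl \<open>\<triangleright>\<close> 70)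
    and lt :: "'a \<Rightarrow> 'a \<Rightarrow> 'a"  (infixl \<open>\<triangleleft>\<close> 70)
  assumes rt_closed: "x \<in> R \<Longrightarrow> y \<in> R \<Longrightarrow> x \<triangleright> y \<in> R"
    and lt_closed: "x \<in> R \<Longrightarrow> y \<in> R \<Longrightarrow> x \<triangleleft> y \<in> R"
    and rt_lt: "x \<in> R \<Longrightarrow> y \<in> R \<Longrightarrow> x \<triangleright> (y \<triangleleft> x) = y"
    and lt_rt: "x \<in> R \<Longrightarrow> y \<in> R \<Longrightarrow> (x \<triangleright> y) \<triangleleft> x = y"
    and rt_distrib: "x \<in> R \<Longrightarrow> y \<in> R \<Longrightarrow> z \<in> R \<Longrightarrow>
      x \<triangleright> (y \<triangleright> z) = (x \<triangleright> y) \<triangleright> (x \<triangleright> z)"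
    and lt_distrib: "x \<in> R \<Longrightarrow> y \<in> R \<Longrightarrow> z \<in> R \<Longrightarrow>
      (x \<triangleleft> y) \<triangleleft> z = (x \<triangleleft> z) \<triangleleft> (y \<triangleleft> z)"

locale quandle = rack +
  assumes lt_idem: "x \<in> R \<Longrightarrow> x \<triangleleft> x = x"
    and rt_idem: "x \<in> R \<Longrightarrow> x \<triangleright> x = x"

locale crossed_module = group_hom P H \<mu>
  for P (structure) and H (structure) and \<mu> +
  fixes act :: "'c \<Rightarrow> 'a \<Rightarrow> 'a"
  assumes act_hom: "act \<in> hom H (AutoGroup P)"
    and equivariant: "g \<in> carrier H \<Longrightarrow> e \<in> carrier P \<Longrightarrow>
      \<mu> (act g e) = g \<otimes>\<^bsub>H\<^esub> \<mu> e \<otimes>\<^bsub>H\<^esub> inv\<^bsub>H\<^esub> g"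
    and peiffer: "e \<in> carrier P \<Longrightarrow> f \<in> carrier P \<Longrightarrow>
      act (\<mu> e) f = e \<otimes>\<^bsub>P\<^esub> f \<otimes>\<^bsub>P\<^esub> inv\<^bsub>P\<^esub> e"

text \<open>
  The conditions common to framed and unframed pairs. The elements \<open>Z\<close>, \<open>V\<close>, \<open>W\<close> of the
  Reidemeister relations all have the form \<open>opp X Y = X\<inverse> \<mu>(\<phi>(X,Y))\<inverse> Y X\<close>: in R2,
  \<open>Z = opp X Y\<close>; in R3, \<open>Z = opp Y X\<close>, \<open>V = opp T Y\<close> and \<open>W = opp T X\<close>.
\<close>

locale pre_reidemeister_pair = crossed_module P H \<mu> act
  for P (structure) and H (structure) and \<mu> and act +
  fixes \<psi> \<phi> :: "'c \<Rightarrow> 'c \<Rightarrow> 'a"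
  assumes psi_closed: "X \<in> carrier H \<Longrightarrow> Y \<in> carrier H \<Longrightarrow> \<psi> X Y \<in> carrier P"
    and phi_closed: "X \<in> carrier H \<Longrightarrow> Y \<in> carrier H \<Longrightarrow> \<phi> X Y \<in> carrier P"
begin

definition opp :: "'c \<Rightarrow> 'c \<Rightarrow> 'c" where
  "opp X Y = inv\<^bsub>H\<^esub> X \<otimes>\<^bsub>H\<^esub> inv\<^bsub>H\<^esub> (\<mu> (\<phi> X Y)) \<otimes>\<^bsub>H\<^esub> Y \<otimes>\<^bsub>H\<^esub> X"

definition R1 :: bool where
  "R1 \<longleftrightarrow> (\<forall>X\<in>carrier H. \<psi> X X = \<one>\<^bsub>P\<^esub>)"

definition R2 :: bool where
  "R2 \<longleftrightarrow> (\<forall>X\<in>carrier H. \<forall>Y\<in>carrier H. \<phi> X Y \<otimes>\<^bsub>P\<^esub> \<psi> X (opp X Y) = \<one>\<^bsub>P\<^esub>)"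

definition R3 :: bool where
  "R3 \<longleftrightarrow> (\<forall>X\<in>carrier H. \<forall>Y\<in>carrier H. \<forall>T\<in>carrier H.
    \<phi> Y X \<otimes>\<^bsub>P\<^esub> act Y (\<phi> T (opp Y X)) \<otimes>\<^bsub>P\<^esub> \<phi> T Y =
    act X (\<phi> T Y) \<otimes>\<^bsub>P\<^esub> \<phi> T X \<otimes>\<^bsub>P\<^esub> act T (\<phi> (opp T Y) (opp T X)))"

definition kink_unique :: bool where
  "kink_unique \<longleftrightarrow> (\<forall>Z\<in>carrier H. \<exists>!A. A \<in> carrier H \<and> \<mu> (\<phi> A Z) \<otimes>\<^bsub>H\<^esub> A = Z)"

text \<open>\<open>kink_f\<close> is only meaningful under \<open>kink_unique\<close>.\<close>

definition kink_f :: "'c \<Rightarrow> 'c" where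
  "kink_f Z = (THE A. A \<in> carrier H \<and> \<mu> (\<phi> A Z) \<otimes>\<^bsub>H\<^esub> A = Z)"

definition kink_g :: "'c \<Rightarrow> 'c" where
  "kink_g A = inv\<^bsub>H\<^esub> (\<mu> (\<psi> A A)) \<otimes>\<^bsub>H\<^esub> A"

end

locale unframed_reidemeister_pair = pre_reidemeister_pair +
  assumes R1: R1 and R2: R2 and R3: R3

locale framed_reidemeister_pair = pre_reidemeister_pair +
  assumes R2: R2 and R3: R3
    and kink_unique: kink_unique
    and kink_f_g: "A \<in> carrier H \<Longrightarrow> kink_f (kink_g A) = A"
    and kink_g_f: "A \<in> carrier H \<Longrightarrow> kink_g (kink_f A) = A"

definition rack_psi ::
  "('a, 'b) monoid_scheme \<Rightarrow> ('a \<Rightarrow> 'a \<Rightarrow> 'a) \<Rightarrow> 'a \<Rightarrow> 'a \<Rightarrow> 'a" where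
  "rack_psi G rt B A = B \<otimes>\<^bsub>G\<^esub> A \<otimes>\<^bsub>G\<^esub> inv\<^bsub>G\<^esub> B \<otimes>\<^bsub>G\<^esub> inv\<^bsub>G\<^esub> (rt B A)"

definition rack_phi ::
  "('a, 'b) monoid_scheme \<Rightarrow> ('a \<Rightarrow> 'a \<Rightarrow> 'a) \<Rightarrow> 'a \<Rightarrow> 'a \<Rightarrow> 'a" where
  "rack_phi G lt B A = A \<otimes>\<^bsub>G\<^esub> B \<otimes>\<^bsub>G\<^esub> inv\<^bsub>G\<^esub> (lt A B) \<otimes>\<^bsub>G\<^esub> inv\<^bsub>G\<^esub> B"

text \<open>Restricted to the carrier because members of \<^const>\<open>AutoGroup\<close> are extensional functions.\<close>

definition conj_act :: "('a, 'b) monoid_scheme \<Rightarrow> 'a \<Rightarrow> 'a \<Rightarrow> 'a" where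
  "conj_act G = (\<lambda>g. \<lambda>e\<in>carrier G. g \<otimes>\<^bsub>G\<^esub> e \<otimes>\<^bsub>G\<^esub> inv\<^bsub>G\<^esub> g)"

end

theory Submission
  imports Defs
begin

text \<open>
  For \<open>\<phi>\<close> and \<open>\<psi>\<close> as given, the element \<open>opp X Y\<close> collapses to \<open>Y \<triangleleft> X\<close>, so R2 becomes the
  mutual inverse law of the two operations, and both sides of R3 telescope to
  \<open>X Y T ((X \<triangleleft> Y) \<triangleleft> T)\<inverse> (Y \<triangleleft> T)\<inverse> T\<inverse>\<close> by distributivity of \<open>\<triangleleft>\<close>. The kink equation for
  \<open>A\<close> and \<open>Z\<close> says \<open>Z \<triangleleft> A = A\<close>, and \<open>kink_g A = A \<triangleright> A\<close>. Since \<open>A\<close>, \<open>A \<triangleright> A\<close> and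
  \<open>A \<triangleleft> A\<close> all act in the same way on a rack, \<open>A \<mapsto> A \<triangleleft> A\<close> is the inverse of \<open>A \<mapsto> A \<triangleright> A\<close>.
\<close>

context rack
begin

text \<open>Every \<open>y\<close> is \<open>(x \<triangleright> y) \<triangleleft> x\<close>;
  distributing a further \<open>\<triangleleft> x\<close> over this product turns the acting
  \<open>x\<close> into \<open>x \<triangleleft> x\<close>.\<close>

lemma lt_by_lt_self:
  assumes "x \<in> R" "y \<in> R"
  shows "y \<triangleleft> (x \<triangleleft> x) = y \<triangleleft> x"
  using assms lt_distrib[of "x \<triangleright> y" x x] by (simp add: rt_closed lt_rt)

lemma rt_by_rt_self:
  assumes "x \<in> R" "y \<in> R"
  shows "(x \<triangleright> x) \<triangleright> y = x \<triangleright> y"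
  using assms rt_distrib[of x x "y \<triangleleft> x"] by (simp add: lt_closed rt_lt)

text \<open>Left translations by \<open>x\<close> and \<open>x \<triangleright> x\<close> agree,
  hence so do their inverses.\<close>

lemma lt_by_rt_self:
  assumes "x \<in> R" "y \<in> R"
  shows "y \<triangleleft> (x \<triangleright> x) = y \<triangleleft> x"
proof -
  have "x \<triangleright> (y \<triangleleft> (x \<triangleright> x)) = y"
    using assms by (metis lt_closed rt_closed rt_lt rt_by_rt_self)
  then show ?thesis
    using assms lt_rt[of x "y \<triangleleft> (x \<triangleright> x)"] by (simp add: lt_closed rt_closed)
qed

lemma lt_self_rt_self: "x \<in> R \<Longrightarrow> (x \<triangleright> x) \<triangleleft> (x \<triangleright> x) = x"
  by (simp add: lt_by_rt_self rt_closed lt_rt)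

text \<open>Applying \<open>x \<triangleright>\<close> to the first equation gives
  \<open>z = x \<triangleright> x\<close>, and squaring under \<open>\<triangleleft>\<close>
  recovers \<open>x\<close>.\<close>

lemma lt_eq_iff:
  assumes "x \<in> R" "z \<in> R"
  shows "z \<triangleleft> x = x \<longleftrightarrow> x = z \<triangleleft> z"
proof
  assume "z \<triangleleft> x = x"
  then have "x \<triangleright> x = z" using assms rt_lt by metis
  then show "x = z \<triangleleft> z" using assms lt_self_rt_self by metis
qed (use assms lt_by_lt_self in simp)

lemma rt_self_lt_self:
  assumes "x \<in> R"
  shows "(x \<triangleleft> x) \<triangleright> (x \<triangleleft> x) = x"
  using assms rt_lt[of "x \<triangleleft> x" x] by (simp add: lt_by_lt_self lt_closed)

end

context group
begin

lemma inv_mult_cancel_left [simp]: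
  "x \<in> carrier G \<Longrightarrow> y \<in> carrier G \<Longrightarrow> inv x \<otimes> (x \<otimes> y) = y"
  by (simp flip: m_assoc)

lemma mult_inv_cancel_left [simp]:
  "x \<in> carrier G \<Longrightarrow> y \<in> carrier G \<Longrightarrow> x \<otimes> (inv x \<otimes> y) = y"
  by (simp flip: m_assoc)

lemma conj_act_apply:
  "x \<in> carrier G \<Longrightarrow> conj_act G g x = g \<otimes> x \<otimes> inv g"
  by (simp add: conj_act_def)

lemma conj_act_auto:
  assumes "g \<in> carrier G"
  shows "conj_act G g \<in> auto G"
proof -
  have "conj_act G g \<in> hom G G"
    using assms by (intro homI) (simp_all add: conj_act_apply m_assoc)
  moreover have "bij_betw (conj_act G g) (carrier G) (carrier G)"
    using assms by (intro bij_betw_byWitness[where f' = "conj_act G (inv g)"])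
      (auto simp: conj_act_apply m_assoc)
  ultimately show ?thesis
    by (simp add: auto_def Bij_def conj_act_def)
qed

lemma conj_act_hom_AutoGroup: "conj_act G \<in> hom G (AutoGroup G)"
proof (rule homI)
  fix g h assume gh: "g \<in> carrier G" "h \<in> carrier G"
  \<comment> \<open>Multiplication in \<open>BijGroup\<close> is restricted to \<open>Bij\<close>,
    so it reduces to \<open>compose\<close> only for known members.\<close>
  then have "conj_act G g \<in> Bij (carrier G)" "conj_act G h \<in> Bij (carrier G)"
    using conj_act_auto by (auto simp: auto_def)
  with gh show "conj_act G (g \<otimes> h) = conj_act G g \<otimes>\<^bsub>AutoGroup G\<^esub> conj_act G h"
    by (simp add: AutoGroup_def BijGroup_def)
      (auto simp: conj_act_def compose_def m_assoc inv_mult_group fun_eq_iff)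
qed (simp add: AutoGroup_def conj_act_auto)

lemma crossed_module_conj_act: "crossed_module G G id (conj_act G)"
proof -
  interpret group_hom G G id
    by unfold_locales (simp add: hom_def)
  show ?thesis
    by unfold_locales (simp_all add: conj_act_hom_AutoGroup conj_act_apply)
qed

end

locale rack_group = rack R rt lt + group G
  for R :: "'a set"
    and rt :: "'a \<Rightarrow> 'a \<Rightarrow> 'a"  (infixl \<open>\<triangleright>\<close> 70)
    and lt :: "'a \<Rightarrow> 'a \<Rightarrow> 'a"  (infixl \<open>\<triangleleft>\<close> 70)
    and G :: "('a, 'b) monoid_scheme" (structure) +
  assumes carrier_eq: "carrier G = R"
begin

lemma lt_carrier [simp]: "x \<in> carrier G \<Longrightarrow> y \<in> carrier G \<Longrightarrow> x \<triangleleft> y \<in> carrier G"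
  by (simp add: carrier_eq lt_closed)

lemma rt_carrier [simp]: "x \<in> carrier G \<Longrightarrow> y \<in> carrier G \<Longrightarrow> x \<triangleright> y \<in> carrier G"
  by (simp add: carrier_eq rt_closed)

lemma pre_reidemeister:
  "pre_reidemeister_pair G G id (conj_act G) (rack_psi G rt) (rack_phi G lt)"
  unfolding pre_reidemeister_pair_def pre_reidemeister_pair_axioms_def
  by (simp add: crossed_module_conj_act rack_psi_def rack_phi_def)

sublocale pre_reidemeister_pair G G id "conj_act G" "rack_psi G rt" "rack_phi G lt"
  by (rule pre_reidemeister)

lemma opp_eq:
  "X \<in> carrier G \<Longrightarrow> Y \<in> carrier G \<Longrightarrow> opp X Y = Y \<triangleleft> X"
  by (simp add: opp_def rack_phi_def m_assoc inv_mult_group)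

text \<open>The product cancels to
  \<open>Y \<otimes> inv (X \<triangleright> (Y \<triangleleft> X))\<close>.\<close>

lemma R2_holds: R2
  by (simp add: R2_def opp_eq rack_phi_def rack_psi_def m_assoc rt_lt flip: carrier_eq)

lemma R3_holds: R3
  unfolding R3_def
proof (intro ballI)
  fix X Y T assume XYT: "X \<in> carrier G" "Y \<in> carrier G" "T \<in> carrier G"
  \<comment> \<open>After cancellation the two sides of R3 differ in one factor only: the inverse of
    the left or of the right side of this equation.\<close>
  then have "X \<triangleleft> Y \<triangleleft> T = (X \<triangleleft> T) \<triangleleft> (Y \<triangleleft> T)"
    by (simp add: carrier_eq lt_distrib)
  with XYT show "rack_phi G lt Y X \<otimes> conj_act G Y (rack_phi G lt T (opp Y X)) \<otimes> rack_phi G lt T Y =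
      conj_act G X (rack_phi G lt T Y) \<otimes> rack_phi G lt T X \<otimes>
      conj_act G T (rack_phi G lt (opp T Y) (opp T X))"
    by (simp add: opp_eq rack_phi_def conj_act_apply m_assoc inv_mult_group)
qed

lemma kink_iff:
  assumes "A \<in> carrier G" "Z \<in> carrier G"
  shows "id (rack_phi G lt A Z) \<otimes> A = Z \<longleftrightarrow> A = Z \<triangleleft> Z"
proof -
  have "id (rack_phi G lt A Z) \<otimes> A = Z \<otimes> (A \<otimes> inv (Z \<triangleleft> A))"
    using assms by (simp add: rack_phi_def m_assoc)
  also have "\<dots> = Z \<longleftrightarrow> A \<otimes> inv (Z \<triangleleft> A) = \<one>"
    using assms by simp
  also have "\<dots> \<longleftrightarrow> Z \<triangleleft> A = A"
    using assms inv_solve_right[of \<one> A "Z \<triangleleft> A"] by auto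
  also have "\<dots> \<longleftrightarrow> A = Z \<triangleleft> Z"
    using assms by (simp add: lt_eq_iff carrier_eq)
  finally show ?thesis .
qed

text \<open>Absorbing the membership condition makes the predicate in \<open>kink_unique\<close> and
  \<open>kink_f\<close> equality with a single element.\<close>

lemma kink_conj_iff:
  "Z \<in> carrier G \<Longrightarrow>
    A \<in> carrier G \<and> id (rack_phi G lt A Z) \<otimes> A = Z \<longleftrightarrow> A = Z \<triangleleft> Z"
  using kink_iff by auto

lemma kink_unique_holds: kink_unique
  unfolding kink_unique_def by (intro ballI) (simp only: kink_conj_iff, simp)

lemma kink_f_eq: "Z \<in> carrier G \<Longrightarrow> kink_f Z = Z \<triangleleft> Z"
  unfolding kink_f_def by (simp only: kink_conj_iff) simp

text \<open>Here \<open>\<psi> A A\<close> reduces to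
  \<open>A \<otimes> inv (A \<triangleright> A)\<close>.\<close>

lemma kink_g_eq: "A \<in> carrier G \<Longrightarrow> kink_g A = A \<triangleright> A"
  by (simp add: kink_g_def rack_psi_def m_assoc inv_mult_group)

lemma framed:
  "framed_reidemeister_pair G G id (conj_act G) (rack_psi G rt) (rack_phi G lt)"
  by unfold_locales
    (simp_all add: R2_holds R3_holds kink_unique_holds kink_f_eq kink_g_eq
      carrier_eq lt_closed rt_closed lt_self_rt_self rt_self_lt_self)

lemma unframed:
  assumes "quandle R rt lt"
  shows "unframed_reidemeister_pair G G id (conj_act G) (rack_psi G rt) (rack_phi G lt)"
proof unfold_locales
  show R1
    \<comment> \<open>Idempotence reduces \<open>\<psi> X X\<close> to
      \<open>X \<otimes> inv X\<close>.\<close>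
    using quandle.rt_idem[OF assms] by (simp add: R1_def rack_psi_def m_assoc flip: carrier_eq)
qed (rule R2_holds R3_holds)+

end

theorem theorem4p3:
  fixes R :: "'a set"
    and rt lt :: "'a \<Rightarrow> 'a \<Rightarrow> 'a"
    and G :: "('a, 'b) monoid_scheme"
  assumes "rack R rt lt"
    and "finite R"
    and "group G"
    and "carrier G = R"
  shows "framed_reidemeister_pair G G id (conj_act G) (rack_psi G rt) (rack_phi G lt) \<and>
    (quandle R rt lt \<longrightarrow>
      unframed_reidemeister_pair G G id (conj_act G) (rack_psi G rt) (rack_phi G lt))"
proof -
  interpret rack_group R rt lt G
    using assms by (simp add: rack_group_def rack_group_axioms_def)
  show ?thesis
    using framed unframed by blast
qed

end
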